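(* Let $P(z)$ be a polynomial of degree $n$ with complex coefficients. Then for every complex number $\alpha$ and every real $p \ge 1$, $$\left\{ \int_0^{2\pi} \left| D_\alpha P(e^{i\theta}) \right|^p \, d\theta \right\}^{1/p} \le n(|\alpha| + 1)\left\{ \int_0^{2\pi} \left| P(e^{i\theta}) \right|^p \, d\theta \right\}^{1/p}.$$
   Context: For a polynomial $P(z)$ of degree $n$ and a complex number $\alpha$, the polar derivative of $P$ with respect to $\alpha$ is the polynomial $D_\alpha P(z) = nP(z) + (\alpha - z)P'(z)$, where $P'$ is the ordinary derivative. *)

theory Defs
  imports "HOL-Analysis.Analysis" "HOL-Computational_Algebra.Polynomial"
begin

(* The factor [:\<alpha>, -1:] is the polynomial \<alpha> - z. *)
definition polar_deriv :: "complex \<Rightarrow> complex poly \<Rightarrow> complex poly" where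
  "polar_deriv \<alpha> P = smult (of_nat (degree P)) P + [:\<alpha>, -1:] * pderiv P"

end

theory Submission
  imports Defs
begin

text \<open>
  Write \<open>n\<close> for the degree of \<open>P\<close>. The polar derivative is
  \<open>(n P - z P') + \<alpha> P'\<close>, so that the inequality splits into two estimates of Bernstein
  type: on the unit circle, both \<open>n P - z P'\<close> and \<open>z P'\<close> have \<open>L\<^sup>p\<close> norm at most \<open>n\<close> times
  that of \<open>P\<close>. Both follow from one exact formula in the style of M. Riesz. The operator
  \<open>P \<mapsto> n P - z P'\<close> multiplies the coefficient of \<open>z\<^sup>j\<close> by \<open>n - j\<close>, and the sequence
  \<open>n - \<bar>j\<bar>\<close> consists of the Fourier coefficients of the nonnegative Fejer kernel. Sampling that
  kernel at the roots of unity of order \<open>2 n\<close> gives weights \<open>c\<^sub>w \<ge> 0\<close> of total mass \<open>n\<close> with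
  \<open>\<Sum>c\<^sub>w w\<^sup>j = n - j\<close> for \<open>0 \<le> j \<le> n\<close> (lemma \<open>fejer_weights\<close>). Hence, for unimodular \<open>z\<close>,

  \<^item> \<open>n P(z) - z P'(z)\<close> is the sum of the \<open>c\<^sub>w P(w z)\<close>, and
  \<^item> \<open>z P'(z)\<close> is the sum of the \<open>c\<^sub>w w\<^sup>n P(cnj w z)\<close>, because \<open>j = n - (n - j)\<close>.

  So the polar derivative is bounded pointwise by a combination of \<open>\<bar>P\<bar>\<close> at rotated points with
  nonnegative coefficients of total mass \<open>n (1 + \<bar>\<alpha>\<bar>)\<close> (lemma
  \<open>polar_deriv_interpolation\<close>). Rotations preserve the \<open>L\<^sup>p\<close> norm on the circle, and convexity of
  \<open>x\<^sup>p\<close> shows that such a combination enlarges the norm at most by its total mass (lemma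
  \<open>Lp_norm_le_of_rotations\<close>).
\<close>

section \<open>Nonnegative weights on roots of unity\<close>

text \<open>
  The \<open>N\<close>-th roots of unity are the characters of a cyclic group. Enumerated as powers of a
  primitive root, they turn the sum into a geometric one with a ratio that equals \<open>1\<close> only for
  \<open>a = b\<close>.
\<close>
lemma roots_unity_orthogonality:
  fixes a b N :: nat
  assumes "a < N" "b < N"
  shows "(\<Sum>w | w ^ N = 1. w ^ a * cnj w ^ b) = (if a = b then of_nat N else (0::complex))"
proof -
  define r where "r k = cis (2 * pi * real k / real N)" for k
  define x where "x = r a * cnj (r b)"
  have bij: "bij_betw r {..<N} {w. w ^ N = 1}"
    unfolding r_def using Complex.bij_betw_roots_unity[of N] assms by simp
  have r_swap: "r k ^ l = r l ^ k" for k l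
    by (simp add: r_def Complex.DeMoivre mult_ac)
  have "(\<Sum>w | w ^ N = 1. w ^ a * cnj w ^ b) = (\<Sum>k<N. r k ^ a * cnj (r k) ^ b)"
    using sum.reindex_bij_betw[OF bij, of "\<lambda>w. w ^ a * cnj w ^ b"] by simp
  also have "\<dots> = (\<Sum>k<N. x ^ k)"
    by (simp add: x_def power_mult_distrib r_swap[of _ a] r_swap[of _ b]
        del: complex_cnj_power flip: complex_cnj_power)
  also have "\<dots> = (if a = b then of_nat N else 0)"
  proof (cases "a = b")
    case True
    then show ?thesis by (simp add: x_def r_def cis_cnj cis_mult)
  next
    case False
    have "r a \<in> {w. w ^ N = 1}" "r b \<in> {w. w ^ N = 1}"
      using bij assms by (auto simp: bij_betw_def)
    then have "x ^ N = 1"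
      by (simp add: x_def power_mult_distrib flip: complex_cnj_power)
    moreover have "x \<noteq> 1"
    proof
      assume "x = 1"
      moreover have "cnj (r b) * r b = 1" by (simp add: r_def cis_cnj cis_mult)
      ultimately have "r a = r b" by (metis x_def mult.assoc mult.left_neutral mult.right_neutral)
      with bij assms False show False by (auto simp: bij_betw_def inj_on_def)
    qed
    ultimately show ?thesis using False by (simp add: geometric_sum)
  qed
  finally show ?thesis .
qed

text \<open>
  The weights are the values of the Fejer kernel \<open>\<bar>1 + w + \<dots> + w\<^bsup>n-1\<^esup>\<bar>\<^sup>2\<close> divided by
  \<open>2 n\<close>. Expanded, the kernel contains \<open>w\<^bsup>a-b\<^esup>\<close> for each pair \<open>a, b < n\<close>, and
  \<open>n - j\<close> of these pairs have \<open>b = a + j\<close>. The case \<open>j = 0\<close> gives the total mass \<open>n\<close>.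
\<close>
lemma fejer_weights:
  fixes n :: nat
  obtains S :: "complex set" and c :: "complex \<Rightarrow> real"
  where "finite S" and "\<And>w. w \<in> S \<Longrightarrow> cmod w = 1" and "\<And>w. c w \<ge> 0"
    and "\<And>j. j \<le> n \<Longrightarrow> (\<Sum>w\<in>S. of_real (c w) * w ^ j) = of_nat (n - j)"
proof (cases "n = 0")
  case True
  then show thesis by (intro that[of "{}" "\<lambda>_. 0"]) auto
next
  case False
  define S :: "complex set" where "S = {w. w ^ (2 * n) = 1}"
  define c where "c w = (cmod (\<Sum>k<n. w ^ k))\<^sup>2 / real (2 * n)" for w
  have moment: "(\<Sum>w\<in>S. of_real (c w) * w ^ j) = of_nat (n - j)" if j: "j \<le> n" for j
  proof -
    have "of_nat (2 * n) * (\<Sum>w\<in>S. of_real (c w) * w ^ j)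
        = (\<Sum>w\<in>S. \<Sum>a<n. \<Sum>b<n. w ^ (a + j) * cnj w ^ b)"
      unfolding sum_distrib_left
    proof (intro sum.cong refl)
      fix w
      have "of_nat (2 * n) * (complex_of_real (c w) * w ^ j)
          = w ^ j * of_real ((cmod (\<Sum>k<n. w ^ k))\<^sup>2)"
        using False by (simp add: c_def)
      also have "\<dots> = w ^ j * ((\<Sum>a<n. w ^ a) * (\<Sum>b<n. cnj w ^ b))"
        by (simp only: complex_norm_square cnj_sum complex_cnj_power)
      also have "\<dots> = w ^ j * (\<Sum>a<n. \<Sum>b<n. w ^ a * cnj w ^ b)"
        by (simp only: sum_product)
      also have "\<dots> = (\<Sum>a<n. \<Sum>b<n. w ^ (a + j) * cnj w ^ b)"
        by (simp only: sum_distrib_left power_add mult_ac)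
      finally show "of_nat (2 * n) * (complex_of_real (c w) * w ^ j)
          = (\<Sum>a<n. \<Sum>b<n. w ^ (a + j) * cnj w ^ b)" .
    qed
    also have "\<dots> = (\<Sum>a<n. \<Sum>b<n. \<Sum>w\<in>S. w ^ (a + j) * cnj w ^ b)"
      by (subst sum.swap) (intro sum.cong refl sum.swap)
    \<comment> \<open>The exponents \<^term>\<open>a + j\<close> and \<^term>\<open>b\<close> are both below \<^term>\<open>2 * n\<close>, so that
      orthogonality sees only \<^prop>\<open>a + j = b\<close> and no aliasing occurs.\<close>
    also have "\<dots> = (\<Sum>a<n. \<Sum>b<n. if a + j = b then of_nat (2 * n) else 0)"
      unfolding S_def using j by (intro sum.cong refl roots_unity_orthogonality) auto
    also have "\<dots> = (\<Sum>a<n. if a < n - j then of_nat (2 * n) else 0)"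
      by (intro sum.cong refl) auto
    also have "\<dots> = of_nat (2 * n) * of_nat (n - j)"
    proof -
      have "{..<n} \<inter> {a. a < n - j} = {..<n - j}" by auto
      then show ?thesis by (simp add: sum.If_cases)
    qed
    finally show ?thesis using False by simp
  qed
  show thesis
  proof (rule that[of S c])
    show "finite S" unfolding S_def using False by (intro finite_roots_unity) auto
    show "cmod w = 1" if "w \<in> S" for w
      using that False power_eq_1_iff[of w "2 * n"] by (auto simp: S_def)
  qed (use moment in \<open>auto simp: c_def\<close>)
qed

section \<open>Interpolation formula for the polar derivative\<close>

lemma poly_pderiv_times_z:
  fixes z :: "'a::idom"
  shows "z * poly (pderiv P) z = (\<Sum>i\<le>degree P. of_nat i * (coeff P i * z ^ i))"
proof -
  have "z * poly (pderiv P) z = z * poly (pderiv (\<Sum>i\<le>degree P. monom (coeff P i) i)) z"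
    by (simp only: poly_as_sum_of_monoms)
  also have "\<dots> = (\<Sum>i\<le>degree P. z * (of_nat i * coeff P i * z ^ (i - 1)))"
    by (simp add: higher_pderiv_sum[of 1, simplified] pderiv_monom poly_sum poly_monom sum_distrib_left)
  also have "\<dots> = (\<Sum>i\<le>degree P. of_nat i * (coeff P i * z ^ i))"
  proof (intro sum.cong refl)
    fix i show "z * (of_nat i * coeff P i * z ^ (i - 1)) = of_nat i * (coeff P i * z ^ i)"
      by (cases i) (simp_all add: mult_ac)
  qed
  finally show ?thesis .
qed

text \<open>
  Applying the moments \<open>n - j\<close> coefficientwise to \<open>P(w z)\<close> produces \<open>n P - z P'\<close>. In the second
  sum the factor \<open>w\<^sup>n\<close> turns \<open>cnj w\<^sup>j\<close> into \<open>w\<^bsup>n-j\<^esup>\<close>, whose moment is \<open>j\<close>; this produces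
  \<open>z P'\<close>, and the factor \<open>cnj z\<close>, which inverts \<open>z\<close> on the unit circle, recovers \<open>P'\<close>.
\<close>
lemma polar_deriv_interpolation:
  assumes unit: "\<And>w. w \<in> S \<Longrightarrow> cmod w = 1"
    and moment: "\<And>j. j \<le> degree P \<Longrightarrow> (\<Sum>w\<in>S. of_real (c w) * w ^ j) = of_nat (degree P - j)"
    and z: "cmod z = 1"
  shows "poly (polar_deriv \<alpha> P) z
     = (\<Sum>w\<in>S. of_real (c w) * poly P (w * z))
       + \<alpha> * cnj z * (\<Sum>w\<in>S. of_real (c w) * w ^ degree P * poly P (cnj w * z))"
proof -
  define n where "n = degree P"
  have zP': "z * poly (pderiv P) z = (\<Sum>i\<le>n. of_nat i * (coeff P i * z ^ i))"
    unfolding n_def by (rule poly_pderiv_times_z)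
  have "(\<Sum>w\<in>S. of_real (c w) * poly P (w * z))
      = (\<Sum>i\<le>n. (\<Sum>w\<in>S. of_real (c w) * w ^ i) * (coeff P i * z ^ i))"
    unfolding poly_altdef n_def sum_distrib_left sum_distrib_right power_mult_distrib
    by (subst sum.swap) (simp only: mult_ac)
  also have "\<dots> = (\<Sum>i\<le>n. of_nat (n - i) * (coeff P i * z ^ i))"
    by (intro sum.cong refl) (simp add: moment n_def)
  also have "\<dots> = of_nat n * poly P z - z * poly (pderiv P) z"
    unfolding zP' poly_altdef[of P] n_def sum_distrib_left sum_subtractf[symmetric]
    by (intro sum.cong refl) (simp add: of_nat_diff algebra_simps)
  finally have A: "(\<Sum>w\<in>S. of_real (c w) * poly P (w * z))
      = of_nat n * poly P z - z * poly (pderiv P) z" .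
  have "(\<Sum>w\<in>S. of_real (c w) * w ^ n * poly P (cnj w * z))
      = (\<Sum>i\<le>n. (\<Sum>w\<in>S. of_real (c w) * (w ^ n * cnj w ^ i)) * (coeff P i * z ^ i))"
    unfolding poly_altdef n_def sum_distrib_left sum_distrib_right power_mult_distrib
    by (subst sum.swap) (simp only: mult_ac)
  also have "\<dots> = (\<Sum>i\<le>n. (\<Sum>w\<in>S. of_real (c w) * w ^ (n - i)) * (coeff P i * z ^ i))"
  proof (intro sum.cong refl arg_cong2[where f = "(*)"])
    fix i w assume "i \<in> {..n}" "w \<in> S"
    then have "w ^ n = w ^ (n - i) * w ^ i" by (simp flip: power_add)
    moreover have "w * cnj w = 1"
      using unit[OF \<open>w \<in> S\<close>] by (simp flip: complex_norm_square)
    then have "w ^ i * cnj w ^ i = 1" by (simp flip: power_mult_distrib)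
    ultimately show "w ^ n * cnj w ^ i = w ^ (n - i)" by (simp add: mult.assoc)
  qed
  also have "\<dots> = z * poly (pderiv P) z"
    unfolding zP' by (intro sum.cong refl) (simp add: moment n_def)
  finally have B: "(\<Sum>w\<in>S. of_real (c w) * w ^ n * poly P (cnj w * z)) = z * poly (pderiv P) z" .
  have "cnj z * z = 1"
    using z by (simp add: mult.commute flip: complex_norm_square)
  then have "cnj z * (z * poly (pderiv P) z) = poly (pderiv P) z"
    by (simp flip: mult.assoc)
  then show ?thesis
    unfolding A B[unfolded n_def] by (simp add: polar_deriv_def n_def algebra_simps)
qed

section \<open>Means over the unit circle\<close>

text \<open>
  Convexity on the closed half-line is needed because \<open>\<bar>P\<bar>\<close> may vanish on the circle. The
  extension from the open half-line amounts to \<open>s\<^sup>p \<le> s\<close> for \<open>0 < s < 1\<close>.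
\<close>
lemma convex_on_powr_nonneg:
  assumes "p \<ge> 1"
  shows "convex_on {0..} (\<lambda>x::real. x powr p)"
proof (intro convex_onI)
  fix t x y :: real
  assume t: "0 < t" "t < 1" and xy: "x \<in> {0..}" "y \<in> {0..}"
  have le: "s powr p \<le> s" if "0 < s" "s < 1" for s :: real
    using powr_mono'[of 1 p s] that assms by simp
  show "((1 - t) *\<^sub>R x + t *\<^sub>R y) powr p \<le> (1 - t) * x powr p + t * y powr p"
  proof (cases "x = 0 \<or> y = 0")
    case True
    then show ?thesis
      using t xy le[of t] le[of "1 - t"] by (auto simp: powr_mult intro!: mult_right_mono)
  next
    case False
    then show ?thesis
      using convex_onD[OF powr_convex[OF assms], of t x y] t xy by auto
  qed
qed auto

text \<open>
  Jensen's inequality for \<open>x\<^sup>p\<close> after normalising the weights to total mass \<open>1\<close>.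
\<close>
lemma powr_weighted_sum_le:
  fixes a x :: "'i \<Rightarrow> real"
  assumes "finite I" "p \<ge> 1" "\<And>i. i \<in> I \<Longrightarrow> a i \<ge> 0" "\<And>i. i \<in> I \<Longrightarrow> x i \<ge> 0"
  shows "(\<Sum>i\<in>I. a i * x i) powr p \<le> sum a I powr (p - 1) * (\<Sum>i\<in>I. a i * x i powr p)"
proof (cases "sum a I = 0")
  case True
  then have "\<forall>i\<in>I. a i = 0" using assms by (simp add: sum_nonneg_eq_0_iff)
  then show ?thesis by simp
next
  case False
  define A where "A = sum a I"
  have A: "A > 0" using False assms by (simp add: A_def order_less_le sum_nonneg)
  have "(\<Sum>i\<in>I. (a i / A) *\<^sub>R x i) powr p \<le> (\<Sum>i\<in>I. a i / A * x i powr p)"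
    using assms A False
    by (intro convex_on_sum[OF _ _ convex_on_powr_nonneg])
       (auto simp: A_def simp flip: sum_divide_distrib)
  then have "((\<Sum>i\<in>I. a i * x i) / A) powr p \<le> (\<Sum>i\<in>I. a i * x i powr p) / A"
    by (simp add: sum_divide_distrib)
  then have "(\<Sum>i\<in>I. a i * x i) powr p / A powr p \<le> (\<Sum>i\<in>I. a i * x i powr p) / A"
    using A assms by (subst (asm) powr_divide) (auto intro: sum_nonneg)
  then show ?thesis
    using A by (simp add: powr_diff field_simps A_def)
qed

lemma integral_periodic_shift:
  fixes f :: "real \<Rightarrow> 'a::banach"
  assumes cont: "continuous_on UNIV f" and per: "\<And>x. f (x + T) = f x" and c: "0 \<le> c" "c \<le> T"
  shows "integral {0..T} (\<lambda>x. f (x + c)) = integral {0..T} f"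
proof -
  have int: "f integrable_on {a..b}" for a b
    by (intro integrable_continuous_real continuous_on_subset[OF cont]) auto
  have "integral {0..T} (\<lambda>x. f (x + c)) = integral {c..T + c} f"
    using integral_shift_real_ivl[of c c "T + c" f] by simp
  also have "\<dots> = integral {c..T} f + integral {T..T + c} f"
    using c int Henstock_Kurzweil_Integration.integral_combine[of c T "T + c" f] by simp
  also have "integral {T..T + c} f = integral {0..c} f"
    using integral_shift_real_ivl[of T T "T + c" f] by (simp add: per)
  also have "integral {c..T} f + integral {0..c} f = integral {0..T} f"
    using c int Henstock_Kurzweil_Integration.integral_combine[of 0 c T f] by (simp add: add.commute)
  finally show ?thesis .
qed

text \<open>
  Multiplication by \<open>w\<close> translates the angle by the argument of \<open>w\<close>, and the integrand has
  period \<open>2 \<pi>\<close>.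
\<close>
lemma circle_integral_rotate:
  fixes F :: "complex \<Rightarrow> 'a::banach"
  assumes cont: "continuous_on (sphere 0 1) F" and w: "cmod w = 1"
  shows "integral {0..2 * pi} (\<lambda>\<theta>. F (w * exp (\<i> * complex_of_real \<theta>)))
       = integral {0..2 * pi} (\<lambda>\<theta>. F (exp (\<i> * complex_of_real \<theta>)))"
proof -
  define f where "f = (\<lambda>\<theta>. F (exp (\<i> * complex_of_real \<theta>)))"
  have "continuous_on UNIV f"
    unfolding f_def by (intro continuous_on_compose2[OF cont] continuous_intros) auto
  moreover have "f (\<theta> + 2 * pi) = f \<theta>" for \<theta>
    unfolding f_def cis_conv_exp[symmetric] by (simp flip: cis_mult)
  moreover have "F (w * exp (\<i> * complex_of_real \<theta>)) = f (\<theta> + Arg2pi w)" for \<theta>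
    using Arg2pi_eq[of w] w by (simp add: f_def exp_add distrib_left mult.commute)
  ultimately show ?thesis
    using integral_periodic_shift[of f "2 * pi" "Arg2pi w"] Arg2pi_ge_0[of w] Arg2pi_lt_2pi[of w]
    by (simp add: f_def less_imp_le)
qed

text \<open>
  This replaces Minkowski's inequality. By Jensen, \<open>\<bar>g\<bar>\<^sup>p\<close> is at most \<open>A\<^bsup>p-1\<^esup>\<close> times the
  weighted sum of the rotated copies of \<open>\<bar>f\<bar>\<^sup>p\<close>, where \<open>A\<close> is the total mass. All the copies
  have the same integral, which leaves the factor \<open>A\<^sup>p\<close>.
\<close>
lemma Lp_norm_le_of_rotations:
  fixes f g :: "complex \<Rightarrow> complex" and p :: real
  assumes "finite I" and a: "\<And>i. i \<in> I \<Longrightarrow> a i \<ge> 0" and u: "\<And>i. i \<in> I \<Longrightarrow> cmod (u i) = 1"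
    and f: "continuous_on (sphere 0 1) f" and g: "continuous_on (sphere 0 1) g"
    and bound: "\<And>z. cmod z = 1 \<Longrightarrow> cmod (g z) \<le> (\<Sum>i\<in>I. a i * cmod (f (u i * z)))"
    and p: "p \<ge> 1"
  shows "(integral {0..2 * pi} (\<lambda>\<theta>. cmod (g (exp (\<i> * complex_of_real \<theta>))) powr p)) powr (1 / p)
    \<le> sum a I *
      (integral {0..2 * pi} (\<lambda>\<theta>. cmod (f (exp (\<i> * complex_of_real \<theta>))) powr p)) powr (1 / p)"
proof -
  let ?e = "\<lambda>\<theta>. exp (\<i> * complex_of_real \<theta>)"
  define A where "A = sum a I"
  define J where "J = integral {0..2 * pi} (\<lambda>\<theta>. cmod (f (?e \<theta>)) powr p)"
  have A: "A \<ge> 0" unfolding A_def using a by (rule sum_nonneg)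
  have cont: "continuous_on (sphere 0 1) (\<lambda>z. cmod (h z) powr p)"
    if "continuous_on (sphere 0 1) h" for h :: "complex \<Rightarrow> complex"
    using that p by (intro continuous_on_powr' continuous_intros) auto
  have integrable: "(\<lambda>\<theta>. cmod (h (v * ?e \<theta>)) powr p) integrable_on {0..2 * pi}"
    if "continuous_on (sphere 0 1) h" "cmod v = 1" for h :: "complex \<Rightarrow> complex" and v
    using that by (intro integrable_continuous_real continuous_on_compose2[OF cont[of h]]
        continuous_intros) (auto simp: norm_mult)
  have J: "J \<ge> 0"
    unfolding J_def by (rule integral_nonneg) (use integrable[OF f, of 1] in auto)
  have "integral {0..2 * pi} (\<lambda>\<theta>. cmod (g (?e \<theta>)) powr p)
     \<le> integral {0..2 * pi} (\<lambda>\<theta>. A powr (p - 1) * (\<Sum>i\<in>I. a i * cmod (f (u i * ?e \<theta>)) powr p))"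
  proof (rule integral_le)
    show "(\<lambda>\<theta>. cmod (g (?e \<theta>)) powr p) integrable_on {0..2 * pi}"
      using integrable[OF g, of 1] by simp
    show "(\<lambda>\<theta>. A powr (p - 1) * (\<Sum>i\<in>I. a i * cmod (f (u i * ?e \<theta>)) powr p))
        integrable_on {0..2 * pi}"
      using \<open>finite I\<close> integrable[OF f u]
      by (intro integrable_on_mult_right integrable_sum) auto
    fix \<theta>
    have "cmod (g (?e \<theta>)) powr p \<le> (\<Sum>i\<in>I. a i * cmod (f (u i * ?e \<theta>))) powr p"
      using p by (intro powr_mono2 bound) auto
    also have "\<dots> \<le> A powr (p - 1) * (\<Sum>i\<in>I. a i * cmod (f (u i * ?e \<theta>)) powr p)"
      unfolding A_def using \<open>finite I\<close> p a by (intro powr_weighted_sum_le) auto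
    finally show "cmod (g (?e \<theta>)) powr p
        \<le> A powr (p - 1) * (\<Sum>i\<in>I. a i * cmod (f (u i * ?e \<theta>)) powr p)" .
  qed
  also have "\<dots> = A powr (p - 1)
      * (\<Sum>i\<in>I. a i * integral {0..2 * pi} (\<lambda>\<theta>. cmod (f (u i * ?e \<theta>)) powr p))"
    using \<open>finite I\<close> integrable[OF f u]
    by (subst integral_mult_right, subst integral_sum)
       (auto intro!: integrable_on_mult_right)
  also have "\<dots> = A powr (p - 1) * (\<Sum>i\<in>I. a i * J)"
    unfolding J_def using circle_integral_rotate[OF cont[OF f] u] by simp
  also have "\<dots> = A powr p * J"
    using A by (simp add: A_def powr_diff flip: sum_distrib_right)
  finally have "integral {0..2 * pi} (\<lambda>\<theta>. cmod (g (?e \<theta>)) powr p) powr (1 / p)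
      \<le> (A powr p * J) powr (1 / p)"
    using p integrable[OF g, of 1] by (intro powr_mono2 integral_nonneg) auto
  also have "\<dots> = A * J powr (1 / p)"
    using A J p by (simp add: powr_mult powr_powr)
  finally show ?thesis unfolding A_def J_def .
qed

section \<open>The inequality\<close>

theorem theorem1:
  fixes P :: "complex poly" and n :: nat and \<alpha> :: complex and p :: real
  assumes "degree P = n"
    and "p \<ge> 1"
  shows "(integral {0..2 * pi}
            (\<lambda>\<theta>::real. cmod (poly (polar_deriv \<alpha> P) (exp (\<i> * complex_of_real \<theta>))) powr p)) powr (1 / p)
       \<le> real n * (cmod \<alpha> + 1) *
         (integral {0..2 * pi}
            (\<lambda>\<theta>::real. cmod (poly P (exp (\<i> * complex_of_real \<theta>))) powr p)) powr (1 / p)"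
proof -
  obtain S c where S: "finite S" "\<And>w. w \<in> S \<Longrightarrow> cmod w = 1" and c: "\<And>w. c w \<ge> 0"
    and moment: "\<And>j. j \<le> n \<Longrightarrow> (\<Sum>w\<in>S. of_real (c w) * w ^ j) = of_nat (n - j)"
    using fejer_weights[of n] by blast
  have "of_real (sum c S) = complex_of_real (real n)" using moment[of 0] by simp
  then have mass: "sum c S = real n" by (simp only: of_real_eq_iff)
  \<comment> \<open>The two sums of the interpolation formula are merged into one family of rotations, indexed by
    two disjoint copies of \<^term>\<open>S\<close>.\<close>
  define a where "a = case_sum c (\<lambda>w. cmod \<alpha> * c w)"
  define u where "u = case_sum (\<lambda>w. w) cnj"
  have "sum a (S <+> S) = sum c S + cmod \<alpha> * sum c S"
    using S by (simp add: sum.Plus a_def sum_distrib_left)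
  then have total: "sum a (S <+> S) = real n * (cmod \<alpha> + 1)"
    by (simp add: mass algebra_simps)
  have bound: "cmod (poly (polar_deriv \<alpha> P) z) \<le> (\<Sum>i\<in>S <+> S. a i * cmod (poly P (u i * z)))"
    if z: "cmod z = 1" for z
  proof -
    have "cmod (poly (polar_deriv \<alpha> P) z)
        \<le> cmod (\<Sum>w\<in>S. of_real (c w) * poly P (w * z))
          + cmod \<alpha> * cmod (\<Sum>w\<in>S. of_real (c w) * w ^ n * poly P (cnj w * z))"
      using polar_deriv_interpolation[of S P c z \<alpha>] S moment z assms(1)
        norm_triangle_ineq[of "\<Sum>w\<in>S. of_real (c w) * poly P (w * z)"
          "\<alpha> * cnj z * (\<Sum>w\<in>S. of_real (c w) * w ^ n * poly P (cnj w * z))"]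
      by (simp add: norm_mult)
    also have "\<dots> \<le> (\<Sum>w\<in>S. c w * cmod (poly P (w * z)))
          + cmod \<alpha> * (\<Sum>w\<in>S. c w * cmod (poly P (cnj w * z)))"
      using S c by (intro add_mono mult_left_mono sum_norm_le)
        (auto simp: norm_mult norm_power)
    also have "\<dots> = (\<Sum>i\<in>S <+> S. a i * cmod (poly P (u i * z)))"
      using S by (simp add: sum.Plus a_def u_def sum_distrib_left mult.assoc)
    finally show ?thesis .
  qed
  have au: "a i \<ge> 0" "cmod (u i) = 1" if "i \<in> S <+> S" for i
    using that S c by (auto simp: a_def u_def)
  then show ?thesis
    unfolding total[symmetric] using S(1) assms(2)
    by (intro Lp_norm_le_of_rotations[OF _ au _ _ bound]) (auto intro!: continuous_intros)
qed

end
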